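(* Let $q$ be a prime power and let $d$ and $n$ be integers. If $d\geq 1$ and $n>2d$, then there exists a completely tight irreducible affine $d$-spread of $\mathrm{AG}(n,q)$.
   Context: $\mathbb{F}_q^n$ is the vector space of dimension $n$ over the finite field $\mathbb{F}_q$, and $\mathrm{AG}(n,q)$ is the corresponding affine space: its points are the vectors of $\mathbb{F}_q^n$ and its subspaces (affine subspaces) are the linear subspaces of $\mathbb{F}_q^n$ and their cosets. If $C=a+S$ with $a\in\mathbb{F}_q^n$ and $S$ a linear subspace of $\mathbb{F}_q^n$, then $S$ is the supporting linear subspace of $C$, and the dimension of $C$ is the algebraic (linear) dimension of $S$; so $\dim C=d$ means $|C|=q^d$. An affine vector space partition of $\mathrm{AG}(n,q)$ is a collection $\mathcal{P}$ of subspaces of $\mathrm{AG}(n,q)$ such that each point of $\mathrm{AG}(n,q)$ is in exactly one subspace of $\mathcal{P}$. If all subspaces in $\mathcal{P}$ have the same dimension $d$, then $\mathcal{P}$ is called an affine $d$-spread. The definition does not require the supporting subspaces to be distinct. $\mathcal{P}$ is completely tight if for all $C,C'\in\mathcal{P}$ whose supporting linear subspaces $S,S'$ satisfy $S\neq S'$, one has $S\cap S'=\{\mathbf{0}\}$. $\mathcal{P}$ is irreducible if there is no subset $\mathcal{P}'\subset\mathcal{P}$ with $1<|\mathcal{P}'|<|\mathcal{P}|$ such that the union of all subspaces in $\mathcal{P}'$ is a subspace of $\mathrm{AG}(n,q)$ (i.e. a linear subspace of $\mathbb{F}_q^n$ or a coset of one). *)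

theory Defs
  imports "HOL-Analysis.Cartesian_Space"
begin

text \<open>
  The affine space \<open>AG(n,q)\<close> is the type \<open>'k ^ 'n\<close>, where \<open>'k\<close> is a finite field with
  \<open>q = CARD('k)\<close> elements and \<open>n = CARD('n)\<close>.  Linear notions over \<open>'k\<close> are the ones with
  prefix \<open>vec\<close>; the constants \<open>affine\<close>, \<open>subspace\<close> and \<open>dim\<close> without this prefix are about
  real vector spaces.
\<close>

definition ag_subspace :: "('k::field ^ 'n) set \<Rightarrow> bool" where
  "ag_subspace C \<longleftrightarrow> (\<exists>a S. vec.subspace S \<and> C = (+) a ` S)"

text \<open>Only meaningful if \<open>ag_subspace C\<close>; then \<open>S\<close> is unique, see \<open>supporting_coset\<close>.\<close>

definition supporting :: "('k::field ^ 'n) set \<Rightarrow> ('k ^ 'n) set" where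
  "supporting C = (THE S. vec.subspace S \<and> (\<exists>a. C = (+) a ` S))"

definition ag_dim :: "('k::field ^ 'n) set \<Rightarrow> nat" where
  "ag_dim C = vec.dim (supporting C)"

definition affine_partition :: "('k::field ^ 'n) set set \<Rightarrow> bool" where
  "affine_partition P \<longleftrightarrow> (\<forall>C\<in>P. ag_subspace C) \<and> (\<forall>x. \<exists>!C. C \<in> P \<and> x \<in> C)"

definition affine_spread :: "nat \<Rightarrow> ('k::field ^ 'n) set set \<Rightarrow> bool" where
  "affine_spread d P \<longleftrightarrow> affine_partition P \<and> (\<forall>C\<in>P. ag_dim C = d)"

definition completely_tight :: "('k::field ^ 'n) set set \<Rightarrow> bool" where
  "completely_tight P \<longleftrightarrow>
    (\<forall>C\<in>P. \<forall>C'\<in>P. supporting C \<noteq> supporting C' \<longrightarrow> supporting C \<inter> supporting C' = {0})"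

definition irreducible_partition :: "('k::{field,finite} ^ 'n) set set \<Rightarrow> bool" where
  "irreducible_partition P \<longleftrightarrow>
    \<not> (\<exists>P'\<subseteq>P. 1 < card P' \<and> card P' < card P \<and> ag_subspace (\<Union>P'))"

lemma coset_eq_imp_subset:
  fixes S T :: "('k::field ^ 'n) set"
  assumes S: "vec.subspace S" and T: "vec.subspace T" and eq: "(+) a ` S = (+) b ` T"
  shows "S \<subseteq> T"
proof
  fix x assume "x \<in> S"
  then have "a + x \<in> (+) b ` T" using eq by blast
  then obtain t where t: "t \<in> T" "a + x = b + t" by blast
  have "a + 0 \<in> (+) b ` T" using eq vec.subspace_0[OF S] by blast
  then obtain u where u: "u \<in> T" "a = b + u" by auto
  have "x = t - u" using t(2) u(2) by (simp add: algebra_simps)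
  then show "x \<in> T" using vec.subspace_diff[OF T t(1) u(1)] by simp
qed

lemma supporting_coset:
  fixes S :: "('k::field ^ 'n) set"
  assumes "vec.subspace S"
  shows "supporting ((+) a ` S) = S"
  unfolding supporting_def
proof (rule the_equality)
  show "vec.subspace S \<and> (\<exists>b. (+) a ` S = (+) b ` S)" using assms by blast
next
  fix T :: "('k ^ 'n) set"
  assume "vec.subspace T \<and> (\<exists>b. (+) a ` S = (+) b ` T)"
  then show "T = S" using coset_eq_imp_subset assms by (metis subset_antisym)
qed

end

theory Submission
  imports Defs "HOL-Algebra.Algebraic_Closure_Type" "HOL-Number_Theory.Residues"
begin

text \<open>
  Let \<open>q = |k|\<close>, \<open>m = n - d\<close>, and let \<open>K\<close> be the field with \<open>q^m\<close> elements.  Choose a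
  \<open>d\<close>-dimensional \<open>k\<close>-subspace \<open>U\<close> of \<open>K\<close> that does not contain \<open>-1\<close> and identify \<open>AG(n,q)\<close>
  with \<open>U \<times> K\<close>.  For \<open>b \<in> K\<close> the cell \<open>C b = {(x, b (1 + x)) | x \<in> U}\<close> is a coset of its
  direction \<open>{(x, b x) | x \<in> U}\<close>, which has dimension \<open>d\<close>.

  \<^item> The cells form a partition: since \<open>1 + x \<noteq> 0\<close>, the point \<open>(x, y)\<close> lies in exactly the
    cell with index \<open>b = y / (1 + x)\<close> (\<open>affine_partition_cells\<close>).

  \<^item> The partition is completely tight: \<open>b x = b' x\<close> with \<open>b \<noteq> b'\<close> forces \<open>x = 0\<close>, because \<open>K\<close>
    is a field (\<open>direction_Int\<close>).

  \<^item> For irreducibility, \<open>U\<close> is moreover chosen such that \<open>g - 1 \<in> U\<close> for a generator \<open>g\<close> of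
    the multiplicative group of \<open>K\<close>.  Let the cells with index in \<open>B\<close> cover exactly an affine
    subspace, and let \<open>b\<close> and \<open>b'\<close> be distinct elements of \<open>B\<close>.  The fibres of the two cells
    over \<open>x = g - 1\<close> differ by \<open>(0, (b' - b) g)\<close>, so this vector is in the direction of the
    subspace; adding it to the point \<open>(0, b)\<close> yields \<open>b + (b' - b) g \<in> B\<close>.  Iterating,
    \<open>b + (b' - b) g^i \<in> B\<close> for all \<open>i\<close>, hence \<open>B = K\<close> and the subset of the partition is not
    proper (\<open>irreducible_cells\<close>).

  Such a \<open>U\<close> exists because \<open>n > 2 d\<close> gives \<open>m > d\<close> and \<open>m \<ge> 2\<close>: then \<open>g \<notin> k\<close>, so \<open>1\<close> and
  \<open>g - 1\<close> are part of a basis of \<open>K\<close>, and \<open>U\<close> can be spanned by \<open>d\<close> basis elements that include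
  \<open>g - 1\<close> but not \<open>1\<close> (\<open>ex_graph_spread\<close>).  The field \<open>K\<close> is realised inside the algebraic
  closure of \<open>k\<close> as the set of roots of \<open>X^(q^m) - X\<close>.
\<close>

text \<open>The symbol \<open>$\<close> shall only denote the coordinates of a vector.\<close>

unbundle no fps_syntax

section \<open>The extension of degree \<open>m\<close> of a finite field\<close>

lemma power_CARD_eq_self:
  fixes x :: "'k::{field,finite}"
  shows "x ^ CARD('k) = x"
proof (cases "x = 0")
  case False
  have "x * (\<Prod>y\<in>UNIV - {0}. x * y) = x * x ^ (CARD('k) - 1) * \<Prod>(UNIV - {0})"
    by (simp add: prod.distrib mult_ac)
  also have "x * x ^ (CARD('k) - 1) = x ^ Suc (CARD('k) - 1)"
    by (subst power_Suc) auto
  also have "Suc (CARD('k) - 1) = CARD('k)"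
    using finite_UNIV_card_ge_0[where ?'a = 'k] by simp
  also have "(\<Prod>y\<in>UNIV - {0}. x * y) = (\<Prod>y\<in>UNIV - {0}. y)"
    by (rule prod.reindex_bij_witness[of _ "\<lambda>y. y / x" "\<lambda>y. x * y"]) (use False in auto)
  finally show ?thesis
    by simp
qed simp

lemma one_less_CARD_field: "1 < CARD('k::{field,finite})"
  using card_mono[of UNIV "{0, 1 :: 'k}"] by simp

lemma to_ac_power_CARD_pow: "to_ac (c :: 'k::{field,finite}) ^ (CARD('k) ^ m) = to_ac c"
proof -
  have "c ^ (CARD('k) ^ m) = c"
    by (induction m) (simp_all add: power_CARD_eq_self power_mult)
  then show ?thesis by (metis to_ac_power)
qed

lemma of_nat_CARD_alg_closure_eq_0: "of_nat (CARD('k)) = (0 :: 'k::{field,finite} alg_closure)"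
  using CHAR_dvd_CARD[where 'a = 'k] by (simp add: of_nat_eq_0_iff_char_dvd)

text \<open>
  The identity \<open>(1 + X)^q = X^q + 1\<close> holds for polynomials, because both sides have degree \<open>q\<close>
  and leading coefficient \<open>1\<close> and agree at the \<open>q\<close> elements \<open>c\<close> of \<open>k\<close>, where \<open>c^q = c\<close>.  The
  general case follows by homogeneity.
\<close>

lemma power_CARD_add:
  fixes x y :: "'k::{field,finite} alg_closure"
  shows "(x + y) ^ CARD('k) = x ^ CARD('k) + y ^ CARD('k)"
proof -
  let ?q = "CARD('k)"
  have q: "?q > 1" by (rule one_less_CARD_field)
  define f g :: "'k alg_closure poly" where "f = [:1, 1:] ^ ?q" and "g = monom 1 ?q + 1"
  have "f = g"
  proof (rule poly_eqI_degree_lead_coeff[where n = ?q and A = "range to_ac"])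
    have df: "degree f = ?q" by (simp add: f_def degree_power_eq)
    then show "degree f \<le> ?q" by simp
    show "degree g \<le> ?q" by (simp add: g_def degree_add_le degree_monom_le)
    have "lead_coeff f = 1" by (simp add: f_def lead_coeff_power)
    then show "poly.coeff f ?q = poly.coeff g ?q" using q df by (simp add: g_def)
    show "?q \<le> card (range (to_ac :: 'k \<Rightarrow> _))" by (simp add: card_image inj_to_ac)
    fix z :: "'k alg_closure" assume "z \<in> range to_ac"
    then obtain c where c: "z = to_ac c" by blast
    have "(1 + to_ac c) ^ ?q = 1 + to_ac c" "to_ac c ^ ?q = to_ac c"
      using to_ac_power_CARD_pow[of "1 + c" 1] to_ac_power_CARD_pow[of c 1] by simp_all
    then show "poly f z = poly g z" by (simp add: f_def g_def c poly_monom)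
  qed
  have eq: "(1 + z) ^ ?q = z ^ ?q + 1" for z :: "'k alg_closure"
    using arg_cong[OF \<open>f = g\<close>, of "\<lambda>p. poly p z"] by (simp add: f_def g_def poly_monom)
  show ?thesis
  proof (cases "y = 0")
    case False
    then have "x + y = y * (1 + x / y)" by (simp add: field_simps)
    then have "(x + y) ^ ?q = y ^ ?q * (1 + x / y) ^ ?q" by (metis power_mult_distrib)
    also have "\<dots> = x ^ ?q + y ^ ?q" unfolding eq using False by (simp add: power_divide distrib_left)
    finally show ?thesis .
  qed (use q in simp)
qed

text \<open>The subfield with \<open>q^m\<close> elements (for \<open>m > 0\<close>), as the fixed points of a power of Frobenius.\<close>

definition finite_subext :: "nat \<Rightarrow> 'k::{field,finite} alg_closure set" where
  "finite_subext m = {x. x ^ (CARD('k) ^ m) = x}"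

lemma power_CARD_pow_add:
  fixes x y :: "'k::{field,finite} alg_closure"
  shows "(x + y) ^ (CARD('k) ^ m) = x ^ (CARD('k) ^ m) + y ^ (CARD('k) ^ m)"
proof (induction m)
  case (Suc m)
  have "z ^ (CARD('k) ^ Suc m) = (z ^ (CARD('k) ^ m)) ^ CARD('k)" for z :: "'k alg_closure"
    by (simp add: mult.commute flip: power_mult)
  then show ?case by (simp only: Suc.IH power_CARD_add)
qed simp

lemma
  fixes x y :: "'k::{field,finite} alg_closure"
  shows to_ac_in_finite_subext: "to_ac c \<in> finite_subext m"
    and finite_subext_0: "(0 :: 'k alg_closure) \<in> finite_subext m"
    and finite_subext_1: "(1 :: 'k alg_closure) \<in> finite_subext m"
    and finite_subext_add: "x \<in> finite_subext m \<Longrightarrow> y \<in> finite_subext m \<Longrightarrow> x + y \<in> finite_subext m"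
    and finite_subext_mult: "x \<in> finite_subext m \<Longrightarrow> y \<in> finite_subext m \<Longrightarrow> x * y \<in> finite_subext m"
    and finite_subext_inverse: "x \<in> finite_subext m \<Longrightarrow> inverse x \<in> finite_subext m"
  by (auto simp: finite_subext_def to_ac_power_CARD_pow power_CARD_pow_add power_mult_distrib power_inverse)

lemma finite_subext_uminus:
  "x \<in> finite_subext m \<Longrightarrow> - x \<in> finite_subext m"
  using finite_subext_mult[OF to_ac_in_finite_subext[of "-1"], of x m] by simp

text \<open>
  In the algebraic closure, \<open>X^(q^m) - X\<close> is a product of linear factors.  They are distinct, as its
  derivative \<open>-1\<close> has no root.
\<close>

lemma card_finite_subext:
  assumes "m > 0"
  shows "card (finite_subext m :: 'k::{field,finite} alg_closure set) = CARD('k) ^ m"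
proof -
  let ?N = "CARD('k) ^ m"
  have N: "?N > 1" using assms one_less_CARD_field by (rule one_less_power[rotated])
  define p :: "'k alg_closure poly" where "p = monom 1 ?N - monom 1 1"
  have deg: "degree p = ?N"
    unfolding p_def diff_conv_add_uminus using N
    by (subst degree_add_eq_left) (auto simp: degree_monom_eq)
  then have "p \<noteq> 0" using N by auto
  have lc: "lead_coeff p = 1" using N by (subst deg) (simp add: p_def)
  obtain A where A: "size A = ?N" "p = (\<Prod>x\<in>#A. [:- x, 1:])"
    using alg_closed_imp_factorization[OF \<open>p \<noteq> 0\<close>] deg lc by auto
  have "of_nat ?N = (0 :: 'k alg_closure)"
    using assms by (simp add: of_nat_CARD_alg_closure_eq_0)
  then have deriv: "pderiv p = - 1"
    by (simp add: p_def pderiv_diff pderiv_monom del: of_nat_power)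
  have "count A x = 1" if "x \<in># A" for x
  proof (rule ccontr)
    assume "count A x \<noteq> 1"
    obtain B where B: "A = add_mset x B" using \<open>x \<in># A\<close> by (rule mset_add)
    with \<open>count A x \<noteq> 1\<close> have "x \<in># B" by (auto simp: count_eq_zero_iff)
    then obtain C where "B = add_mset x C" by (rule mset_add)
    then have "p = [:- x, 1:] * ([:- x, 1:] * (\<Prod>x\<in>#C. [:- x, 1:]))" using A(2) B by simp
    then have "poly (pderiv p) x = 0" by (simp add: pderiv_mult del: mult_pCons_left)
    then show False using deriv by simp
  qed
  then have "card (set_mset A) = ?N" using A(1) by (simp add: size_multiset_overloaded_eq)
  moreover have "finite_subext m = {x. poly p x = 0}"
    by (simp add: finite_subext_def p_def poly_monom)
  moreover have "{x. poly p x = 0} = set_mset A"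
    by (auto simp: A(2) poly_prod_mset)
  ultimately show ?thesis by simp
qed

lemma finite_finite_subext:
  assumes "m > 0"
  shows "finite (finite_subext m :: 'k::{field,finite} alg_closure set)"
  using card_finite_subext[OF assms, where 'k = 'k] by (intro card_ge_0_finite) simp

text \<open>
  The multiplicative group of a finite field is cyclic.  To apply this to the subfield, it is viewed
  as a field record \<open>R\<close> with carrier \<open>finite_subext m\<close>.
\<close>

lemma finite_subext_mult_cyclic:
  assumes "m > 0"
  obtains g :: "'k::{field,finite} alg_closure" where "g \<in> finite_subext m"
    and "\<forall>x\<in>finite_subext m - {0}. \<exists>i. x = g ^ i"
proof -
  let ?K = "finite_subext m :: 'k alg_closure set"
  define R :: "'k alg_closure ring"
    where "R = \<lparr>carrier = ?K, monoid.mult = (\<lambda>x y. x * y), one = 1, ring.zero = 0, add = (\<lambda>x y. x + y)\<rparr>"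
  note simps = R_def finite_subext_0 finite_subext_1 finite_subext_add finite_subext_mult
  have "cring R"
  proof (rule cringI)
    have "\<exists>y\<in>?K. y + x = 0" if "x \<in> ?K" for x
      using finite_subext_uminus[OF that] by (intro bexI[of _ "- x"]) auto
    then show "abelian_group R" by (intro abelian_groupI) (auto simp: simps)
    show "comm_monoid R" by (intro comm_monoidI) (auto simp: simps)
  qed (auto simp: simps algebra_simps)
  moreover have "\<exists>y\<in>?K. x * y = 1" if "x \<in> ?K" "x \<noteq> 0" for x
    using finite_subext_inverse[OF that(1)] that(2) by (intro bexI[of _ "inverse x"]) auto
  ultimately have field: "Ring.field R"
    by (intro cring.cring_fieldI2) (auto simp: R_def)
  let ?G = "Multiplicative_Group.mult_of R"
  have "finite (carrier R)" by (simp add: R_def finite_finite_subext[OF assms])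
  then obtain g where g: "g \<in> carrier ?G"
    and gen: "carrier ?G = {g [^]\<^bsub>R\<^esub> i | i::nat. i \<in> UNIV}"
    by (rule bexE[OF field.finite_field_mult_group_has_gen[OF field]]) auto
  have pow: "g [^]\<^bsub>R\<^esub> (i :: nat) = g ^ i" for i
    by (induction i) (simp_all add: R_def nat_pow_def mult.commute)
  show thesis
  proof
    show "g \<in> ?K" using g by (simp add: R_def Multiplicative_Group.mult_of_simps)
    show "\<forall>x\<in>?K - {0}. \<exists>i. x = g ^ i"
    proof
      fix x assume "x \<in> ?K - {0}"
      then have "x \<in> carrier ?G" by (simp add: R_def Multiplicative_Group.mult_of_simps)
      then show "\<exists>i. x = g ^ i" unfolding gen pow by auto
    qed
  qed
qed

section \<open>Counting in vector spaces and coordinates\<close>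

lemma (in vector_space) card_span_independent:
  assumes B: "independent B" "finite B"
  shows "card (span B) = card (UNIV :: 'a set) ^ card B"
proof -
  let ?F = "B \<rightarrow>\<^sub>E (UNIV :: 'a set)"
  let ?lc = "\<lambda>u. \<Sum>v\<in>B. scale (u v) v"
  have "span B = ?lc ` ?F"
  proof -
    have "?lc u \<in> ?lc ` ?F" for u
    proof (rule image_eqI)
      show "restrict u B \<in> ?F" by (intro restrict_PiE_iff[THEN iffD2] ballI UNIV_I)
      show "?lc u = ?lc (restrict u B)" by (rule sum.cong) simp_all
    qed
    then show ?thesis
      unfolding span_finite[OF B(2)] by (intro equalityI image_subsetI rangeI)
  qed
  moreover have "inj_on ?lc ?F"
  proof (rule inj_onI)
    fix u w assume uw: "u \<in> ?F" "w \<in> ?F" "?lc u = ?lc w"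
    then have "(\<Sum>v\<in>B. scale (u v - w v) v) = 0"
      by (simp add: scale_left_diff_distrib sum_subtractf)
    then have "u v - w v = 0" if "v \<in> B" for v
      using that by (rule independentD[OF B subset_refl, where u = "\<lambda>v. u v - w v"])
    then show "u = w" using uw by (auto intro: PiE_ext)
  qed
  ultimately show ?thesis using B(2) by (simp add: card_image card_PiE)
qed

text \<open>The algebraic closure of \<open>'k\<close> as a vector space over \<open>'k\<close>.\<close>

interpretation ac: vector_space "\<lambda>(c :: 'k::field) (x :: 'k alg_closure). to_ac c * x"
  by unfold_locales (simp_all add: algebra_simps)

abbreviation linear_to_ac :: "('k::field ^ 'n \<Rightarrow> 'k alg_closure) \<Rightarrow> bool" where
  "linear_to_ac \<equiv> Vector_Spaces.linear (*s) (\<lambda>c x. to_ac c * x)"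

lemma linear_to_acI:
  assumes "\<And>v w. f (v + w) = f v + f w" "\<And>c v. f (c *s v) = to_ac c * f v"
  shows "linear_to_ac f"
  using assms vec.vector_space_axioms ac.vector_space_axioms
  by (auto simp: Vector_Spaces.linear_iff)

lemma linear_to_acD:
  assumes "linear_to_ac f"
  shows "f (v + w) = f v + f w" "f (c *s v) = to_ac c * f v" "f (v - w) = f v - f w" "f 0 = 0"
proof -
  interpret Vector_Spaces.linear "(*s)" "\<lambda>c x. to_ac c * x" f by (rule assms)
  show "f (v + w) = f v + f w" "f (c *s v) = to_ac c * f v" "f (v - w) = f v - f w" "f 0 = 0"
    by (simp_all add: add scale diff)
qed

text \<open>
  A splitting of the coordinates of \<open>'k ^ 'n\<close> into \<open>card A\<close> and \<open>card B\<close> many identifies the space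
  with \<open>span A \<times> span B\<close>.
\<close>

lemma ag_coordinates:
  fixes A B :: "'k::{field,finite} alg_closure set"
  assumes A: "ac.independent A" "finite A" and B: "ac.independent B" "finite B"
    and card: "card A + card B = CARD('n::finite)"
  obtains \<pi> \<rho> :: "'k ^ 'n \<Rightarrow> 'k alg_closure"
  where "linear_to_ac \<pi>" "linear_to_ac \<rho>"
    and "bij_betw (\<lambda>v. (\<pi> v, \<rho> v)) UNIV (ac.span A \<times> ac.span B)"
proof -
  have "card A \<le> card (UNIV :: 'n set)" using card by simp
  then obtain I :: "'n set" where I: "card I = card A" by (meson obtain_subset_with_card_n)
  have "card (- I) = card B" using card I by (simp add: card_Diff_subset Compl_eq_Diff_UNIV)
  obtain a where a: "bij_betw a I A"
    using finite_same_card_bij[OF finite A(2) I] ..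
  obtain b where b: "bij_betw b (- I) B"
    using finite_same_card_bij[OF finite B(2) \<open>card (- I) = card B\<close>] ..
  have aux: "(\<Sum>i\<in>J. to_ac (v $ i) * c i) \<in> ac.span C"
    "(\<Sum>i\<in>J. to_ac (v $ i) * c i) = 0 \<Longrightarrow> i \<in> J \<Longrightarrow> v $ i = 0"
    if c: "bij_betw c J C" and C: "ac.independent C" "finite C"
    for c C i and J :: "'n set" and v :: "'k ^ 'n"
  proof -
    show "(\<Sum>i\<in>J. to_ac (v $ i) * c i) \<in> ac.span C"
      using bij_betwE[OF c] by (intro ac.span_sum ac.span_scale ac.span_base) auto
    have inv: "inv_into J c (c i) = i" if "i \<in> J" for i
      using c that by (simp add: bij_betw_def)
    have eq: "(\<Sum>x\<in>C. to_ac (v $ inv_into J c x) * x) = (\<Sum>i\<in>J. to_ac (v $ i) * c i)"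
      by (subst sum.reindex_bij_betw[OF c, symmetric]) (simp add: inv)
    assume zero: "(\<Sum>i\<in>J. to_ac (v $ i) * c i) = 0" and "i \<in> J"
    then have "c i \<in> C" using bij_betwE[OF c] by blast
    then have "v $ inv_into J c (c i) = 0"
      using eq zero by (intro ac.independentD[OF C subset_refl, where u = "\<lambda>x. v $ inv_into J c x"]) simp_all
    then show "v $ i = 0" using inv[OF \<open>i \<in> J\<close>] by simp
  qed
  define \<pi> \<rho> :: "'k ^ 'n \<Rightarrow> 'k alg_closure"
    where "\<pi> v = (\<Sum>i\<in>I. to_ac (v $ i) * a i)" and "\<rho> v = (\<Sum>i\<in>-I. to_ac (v $ i) * b i)" for v
  have lin: "linear_to_ac \<pi>" "linear_to_ac \<rho>"
    by (rule linear_to_acI; simp add: \<pi>_def \<rho>_def algebra_simps sum.distrib sum_distrib_left)+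
  have inj: "inj (\<lambda>v. (\<pi> v, \<rho> v))"
  proof (rule injI)
    fix v w assume "(\<pi> v, \<rho> v) = (\<pi> w, \<rho> w)"
    then have "\<pi> (v - w) = 0" "\<rho> (v - w) = 0"
      using linear_to_acD(3)[OF lin(1)] linear_to_acD(3)[OF lin(2)] by auto
    then have "(v - w) $ i = 0" for i
      using aux(2)[OF a A, of "v - w" i] aux(2)[OF b B, of "v - w" i]
      by (cases "i \<in> I") (simp_all add: \<pi>_def \<rho>_def)
    then show "v = w" by (simp add: vec_eq_iff)
  qed
  \<comment> \<open>Both sides have \<open>q^n\<close> elements, so injectivity implies surjectivity.\<close>
  have "(\<lambda>v. (\<pi> v, \<rho> v)) ` UNIV = ac.span A \<times> ac.span B"
  proof (rule card_subset_eq)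
    have span: "card (ac.span A) = CARD('k) ^ card A" "card (ac.span B) = CARD('k) ^ card B"
      using ac.card_span_independent[OF A] ac.card_span_independent[OF B] by auto
    have "card (ac.span A) > 0" "card (ac.span B) > 0" unfolding span by simp_all
    then show "finite (ac.span A \<times> ac.span B)" using card_ge_0_finite by blast
    show "(\<lambda>v. (\<pi> v, \<rho> v)) ` UNIV \<subseteq> ac.span A \<times> ac.span B"
      using aux(1)[OF a A] aux(1)[OF b B] by (auto simp: \<pi>_def \<rho>_def)
    have "card ((\<lambda>v. (\<pi> v, \<rho> v)) ` UNIV) = CARD('k) ^ (card A + card B)"
      unfolding card_image[OF inj] card by simp
    also have "\<dots> = card (ac.span A \<times> ac.span B)"
      unfolding card_cartesian_product span by (rule power_add)
    finally show "card ((\<lambda>v. (\<pi> v, \<rho> v)) ` UNIV) = card (ac.span A \<times> ac.span B)" .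
  qed
  then have "bij_betw (\<lambda>v. (\<pi> v, \<rho> v)) UNIV (ac.span A \<times> ac.span B)"
    using inj by (intro bij_betw_imageI)
  with lin show thesis by (rule that)
qed

lemma vec_dim_eq_if_card:
  fixes S :: "('k::{field,finite} ^ 'n) set"
  assumes S: "vec.subspace S" and card: "card S = CARD('k) ^ d"
  shows "vec.dim S = d"
proof -
  obtain B where B: "B \<subseteq> S" "vec.independent B" "S \<subseteq> vec.span B" "card B = vec.dim S"
    by (rule vec.basis_exists)
  then have "vec.span B = S" using S vec.span_minimal by blast
  then have "CARD('k) ^ d = CARD('k) ^ vec.dim S"
    using vec.card_span_independent[OF B(2)] B(4) card by simp
  then show ?thesis using one_less_CARD_field[where 'k = 'k] by simp
qed

section \<open>The partition into graphs\<close>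

text \<open>
  The maps \<open>\<pi>\<close> and \<open>\<rho>\<close> are linear coordinates that identify the affine space with \<open>U \<times> K\<close>.  In
  particular \<open>U\<close> is the range of \<open>\<pi>\<close> and thus a linear subspace of \<open>K\<close>.
\<close>

locale graph_spread =
  fixes m :: nat and U :: "'k::{field,finite} alg_closure set"
    and \<pi> \<rho> :: "'k ^ 'n \<Rightarrow> 'k alg_closure"
  assumes linear: "linear_to_ac \<pi>" "linear_to_ac \<rho>"
    and coordinates: "bij_betw (\<lambda>v. (\<pi> v, \<rho> v)) UNIV (U \<times> finite_subext m)"
    and U_subset: "U \<subseteq> finite_subext m" and minus_1_notin_U: "- 1 \<notin> U"
begin

abbreviation K :: "'k alg_closure set" where "K \<equiv> finite_subext m"

lemmas \<pi>_simps = linear_to_acD[OF linear(1)] and \<rho>_simps = linear_to_acD[OF linear(2)]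

lemma \<pi>_in_U: "\<pi> v \<in> U" and \<rho>_in_K: "\<rho> v \<in> K"
  using bij_betwE[OF coordinates] by auto

lemma zero_in_U: "0 \<in> U"
  using \<pi>_in_U[of 0] by (simp add: \<pi>_simps)

lemma coordinates_eqI: "\<pi> v = \<pi> w \<Longrightarrow> \<rho> v = \<rho> w \<Longrightarrow> v = w"
  using bij_betw_imp_inj_on[OF coordinates] by (auto dest: injD)

lemma coordinates_exist:
  assumes "x \<in> U" "y \<in> K"
  obtains v where "\<pi> v = x" "\<rho> v = y"
proof -
  have "(x, y) \<in> range (\<lambda>v. (\<pi> v, \<rho> v))"
    using coordinates assms by (simp add: bij_betw_def)
  then show thesis using that by auto
qed

text \<open>In the coordinates, \<open>direction b\<close> is the graph of \<open>x \<mapsto> b x\<close> and \<open>cell b\<close> that of \<open>x \<mapsto> b (1 + x)\<close>.\<close>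

definition direction :: "'k alg_closure \<Rightarrow> ('k ^ 'n) set" where
  "direction b = {v. \<rho> v = b * \<pi> v}"

definition cell :: "'k alg_closure \<Rightarrow> ('k ^ 'n) set" where
  "cell b = {v. \<rho> v = b * (1 + \<pi> v)}"

lemma subspace_direction: "vec.subspace (direction b)"
  by (auto simp: vec.subspace_def direction_def \<pi>_simps \<rho>_simps algebra_simps)

lemma cell_eq_coset:
  assumes "\<pi> a = 0" "\<rho> a = b"
  shows "cell b = (+) a ` direction b"
proof (intro equalityI subsetI)
  fix v assume "v \<in> cell b"
  then have "v - a \<in> direction b"
    using assms by (simp add: cell_def direction_def \<pi>_simps \<rho>_simps algebra_simps)
  then show "v \<in> (+) a ` direction b" by (intro image_eqI[of _ _ "v - a"]) auto
qed (use assms in \<open>auto simp: cell_def direction_def \<pi>_simps \<rho>_simps algebra_simps\<close>)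

lemma
  assumes "b \<in> K"
  shows ag_subspace_cell: "ag_subspace (cell b)"
    and supporting_cell: "supporting (cell b) = direction b"
proof -
  obtain a where "\<pi> a = 0" "\<rho> a = b" using coordinates_exist[OF zero_in_U assms] .
  then have eq: "cell b = (+) a ` direction b" by (rule cell_eq_coset)
  show "ag_subspace (cell b)"
    unfolding ag_subspace_def using eq subspace_direction by blast
  show "supporting (cell b) = direction b"
    unfolding eq using subspace_direction by (rule supporting_coset)
qed

text \<open>A graph over \<open>U\<close> is in bijection with \<open>U\<close> via the first coordinate.\<close>

lemma card_direction:
  assumes "b \<in> K"
  shows "card (direction b) = card U"
proof -
  have "bij_betw \<pi> (direction b) U"
  proof (rule bij_betw_imageI)
    show "inj_on \<pi> (direction b)"
      by (auto intro!: inj_onI coordinates_eqI simp: direction_def)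
    have "x \<in> \<pi> ` direction b" if "x \<in> U" for x
    proof -
      have "b * x \<in> K" using that assms U_subset by (auto intro: finite_subext_mult)
      with that obtain v where "\<pi> v = x" "\<rho> v = b * x" by (rule coordinates_exist)
      then show ?thesis by (auto simp: direction_def)
    qed
    then show "\<pi> ` direction b = U" using \<pi>_in_U by auto
  qed
  then show ?thesis by (rule bij_betw_same_card)
qed

lemma one_plus_\<pi>_nonzero: "1 + \<pi> v \<noteq> 0"
  using \<pi>_in_U[of v] minus_1_notin_U by (metis add.commute eq_neg_iff_add_eq_0)

text \<open>The index of the cell of a point; this is the reason for \<open>- 1 \<notin> U\<close>.\<close>

lemma mem_cell_iff: "v \<in> cell b \<longleftrightarrow> b = \<rho> v / (1 + \<pi> v)"
  using one_plus_\<pi>_nonzero[of v] by (auto simp: cell_def field_simps)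

lemma cell_index_in_K: "v \<in> cell b \<Longrightarrow> b \<in> K"
  unfolding mem_cell_iff divide_inverse using \<pi>_in_U[of v] \<rho>_in_K[of v] U_subset
  by (auto intro!: finite_subext_mult finite_subext_inverse finite_subext_add finite_subext_1)

lemma affine_partition_cells: "affine_partition (cell ` K)"
proof -
  have "\<exists>!C. C \<in> cell ` K \<and> v \<in> C" for v
  proof (rule ex1I)
    have "v \<in> cell (\<rho> v / (1 + \<pi> v))" by (simp add: mem_cell_iff)
    then show "cell (\<rho> v / (1 + \<pi> v)) \<in> cell ` K \<and> v \<in> cell (\<rho> v / (1 + \<pi> v))"
      using cell_index_in_K by blast
  qed (auto simp: mem_cell_iff)
  then show ?thesis using ag_subspace_cell by (auto simp: affine_partition_def)
qed

lemma affine_spread_cells: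
  assumes "card U = CARD('k) ^ d"
  shows "affine_spread d (cell ` K)"
  unfolding affine_spread_def ag_dim_def
  using assms affine_partition_cells
  by (auto simp: supporting_cell card_direction subspace_direction intro!: vec_dim_eq_if_card)

lemma direction_Int: "b \<noteq> b' \<Longrightarrow> direction b \<inter> direction b' = {0}"
proof (intro equalityI subsetI)
  fix v assume "b \<noteq> b'" "v \<in> direction b \<inter> direction b'"
  then have "\<pi> v = 0" "\<rho> v = 0" by (auto simp: direction_def)
  then have "v = 0" by (intro coordinates_eqI) (simp_all add: \<pi>_simps \<rho>_simps)
  then show "v \<in> {0}" by simp
qed (use vec.subspace_0[OF subspace_direction] in auto)

lemma completely_tight_cells: "completely_tight (cell ` K)"
  unfolding completely_tight_def
proof (intro ballI impI)
  fix C C' assume "C \<in> cell ` K" "C' \<in> cell ` K" and ne: "supporting C \<noteq> supporting C'"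
  then obtain b b' where b: "supporting C = direction b" "supporting C' = direction b'"
    using supporting_cell by blast
  have "b \<noteq> b'" using ne unfolding b by blast
  then show "supporting C \<inter> supporting C' = {0}" unfolding b by (rule direction_Int)
qed

text \<open>
  The indices of the cells that make up an affine subspace are closed under the operation
  \<open>(b, b') \<mapsto> b + (b' - b) g\<close>, and any two distinct elements generate all of \<open>K\<close> under it.
\<close>

lemma irreducible_cells:
  assumes g: "g - 1 \<in> U" and gen: "\<forall>x\<in>K - {0}. \<exists>i. x = g ^ i"
  shows "irreducible_partition (cell ` K)"
  unfolding irreducible_partition_def
proof safe
  fix P assume P: "P \<subseteq> cell ` K" "1 < card P" "card P < card (cell ` K)" "ag_subspace (\<Union>P)"
  define B where "B = {b \<in> K. cell b \<in> P}"
  have P_eq: "P = cell ` B" using P(1) by (auto simp: B_def)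
  have B_sub: "B \<subseteq> K" by (auto simp: B_def)
  obtain c T where T: "vec.subspace T" "\<Union>P = (+) c ` T" using P(4) by (auto simp: ag_subspace_def)
  have in_T: "c + t \<in> \<Union>P \<longleftrightarrow> t \<in> T" for t by (auto simp: T(2))
  have g_K: "g \<in> K" using g U_subset finite_subext_add[OF _ finite_subext_1, of "g - 1" m] by auto
  have step: "b + (b' - b) * g \<in> B" if b: "b \<in> B" and b': "b' \<in> B" for b b'
  proof -
    have bK: "b \<in> K" "b' \<in> K" using b b' B_sub by auto
    obtain v where v: "\<pi> v = g - 1" "\<rho> v = b * g"
      using coordinates_exist[OF g finite_subext_mult[OF bK(1) g_K]] .
    obtain v' where v': "\<pi> v' = g - 1" "\<rho> v' = b' * g"
      using coordinates_exist[OF g finite_subext_mult[OF bK(2) g_K]] .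
    obtain w where w: "\<pi> w = 0" "\<rho> w = b" using coordinates_exist[OF zero_in_U bK(1)] .
    \<comment> \<open>\<open>v' - v\<close> is the vector \<open>(0, (b' - b) g)\<close>; it moves \<open>w\<close> along the fibre over \<open>0\<close>.\<close>
    have "v \<in> cell b" "v' \<in> cell b'" "w \<in> cell b" using v v' w by (auto simp: cell_def)
    then have "v \<in> \<Union>P" "v' \<in> \<Union>P" "w \<in> \<Union>P" using b b' by (auto simp: B_def)
    then have "v - c \<in> T" "v' - c \<in> T" "w - c \<in> T" by (simp_all flip: in_T)
    then have "(w - c) + ((v' - c) - (v - c)) \<in> T"
      by (meson vec.subspace_add vec.subspace_diff T(1))
    then have "w + v' - v \<in> \<Union>P" using in_T[of "(w - c) + ((v' - c) - (v - c))"]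
      by (simp add: algebra_simps)
    then obtain a where a: "a \<in> B" "w + v' - v \<in> cell a" unfolding P_eq by blast
    have "a = b + (b' - b) * g" using a(2) v v' w by (simp add: cell_def \<pi>_simps \<rho>_simps algebra_simps)
    then show ?thesis using a(1) by simp
  qed
  have "finite P" using P(2) by (intro card_ge_0_finite) simp
  then have "\<exists>C\<in>P. \<exists>C'\<in>P. C \<noteq> C'"
    using P(2) card_le_Suc0_iff_eq[of P] by auto
  then obtain b b' where b: "b \<in> B" "b' \<in> B" "b \<noteq> b'" unfolding P_eq by blast
  have powers: "b + (b' - b) * g ^ i \<in> B" for i
  proof (induction i)
    case (Suc i)
    from step[OF b(1) this] show ?case by (simp add: mult.commute mult.left_commute)
  qed (use b in simp)
  have "x \<in> B" if "x \<in> K" for x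
  proof (cases "x = b")
    case False
    have "(x - b) * inverse (b' - b) \<in> K"
      using that b(1,2) B_sub finite_subext_uminus[of b m]
      by (metis diff_conv_add_uminus finite_subext_add finite_subext_inverse finite_subext_mult subsetD)
    moreover have "(x - b) * inverse (b' - b) \<noteq> 0" using False b(3) by simp
    ultimately obtain i where "(x - b) * inverse (b' - b) = g ^ i" using gen by blast
    then have "b + (b' - b) * g ^ i = x" using b(3) by (simp add: field_simps)
    then show ?thesis using powers[of i] by simp
  qed (use b in simp)
  then have "P = cell ` K" using B_sub P_eq by blast
  then show False using P(3) by simp
qed

end

section \<open>Existence\<close>

text \<open>
  \<open>U\<close> is spanned by part of a basis of \<open>K\<close> that extends \<open>{g - 1, 1}\<close>.  As \<open>1\<close> is left out,
  linear independence excludes it, and therefore \<open>- 1\<close>, from \<open>U\<close>.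
\<close>

lemma ex_graph_spread:
  fixes d m :: nat
  assumes "1 \<le> d" "d < m" "d + m = CARD('n::finite)"
  obtains U :: "'k::{field,finite} alg_closure set" and \<pi> \<rho> :: "'k ^ 'n \<Rightarrow> 'k alg_closure" and g
  where "graph_spread m U \<pi> \<rho>" "card U = CARD('k) ^ d" "g - 1 \<in> U"
    and "\<forall>x\<in>finite_subext m - {0}. \<exists>i. x = g ^ i"
proof -
  let ?K = "finite_subext m :: 'k alg_closure set"
  have m: "m > 1" "m > 0" using assms by auto
  have finK: "finite ?K" by (rule finite_finite_subext[OF m(2)])
  obtain g :: "'k alg_closure" where g: "g \<in> ?K" and gen: "\<forall>x\<in>?K - {0}. \<exists>i. x = g ^ i"
    by (rule finite_subext_mult_cyclic[OF m(2)])
  \<comment> \<open>Otherwise all powers of \<open>g\<close> were in \<open>'k\<close>, but \<open>K\<close> is larger as \<open>m > 1\<close>.\<close>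
  have g_notin: "g \<notin> range to_ac"
  proof
    assume "g \<in> range to_ac"
    then obtain c where c: "g = to_ac c" by blast
    have "?K \<subseteq> range to_ac"
    proof
      fix x assume "x \<in> ?K"
      then have "x = 0 \<or> (\<exists>i. x = to_ac (c ^ i))" using gen c by auto
      then show "x \<in> range to_ac" using to_ac_0 by (metis rangeI)
    qed
    then have "card ?K \<le> CARD('k)"
      using card_mono[of "range (to_ac :: 'k \<Rightarrow> _)" ?K] by (simp add: card_image inj_to_ac)
    moreover have "CARD('k) ^ 1 < CARD('k) ^ m"
      using m(1) one_less_CARD_field by (rule power_strict_increasing)
    ultimately show False by (simp add: card_finite_subext[OF m(2)])
  qed
  have g1: "g - 1 \<noteq> 1" "g - 1 \<notin> ac.span {1}"
  proof -
    have "g - 1 \<noteq> to_ac c * 1" for c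
    proof
      assume "g - 1 = to_ac c * 1"
      then have "g = to_ac (c + 1)" by (simp add: diff_eq_eq)
      then show False using g_notin by blast
    qed
    then show "g - 1 \<notin> ac.span {1}" unfolding ac.span_singleton by blast
    then show "g - 1 \<noteq> 1" using ac.span_base[of 1 "{1}"] by auto
  qed
  have "ac.independent {g - 1, 1}"
    using g1(2) by (intro ac.independent_insertI) (simp_all add: ac.independent_empty)
  moreover have "{g - 1, 1} \<subseteq> ?K"
    using g finite_subext_1 finite_subext_add[OF g finite_subext_uminus[OF finite_subext_1]] by auto
  ultimately obtain B where B: "{g - 1, 1} \<subseteq> B" "B \<subseteq> ?K" "ac.independent B" "?K \<subseteq> ac.span B"
    using ac.maximal_independent_subset_extend by metis
  have finB: "finite B" using B(2) finK finite_subset by blast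
  have "ac.subspace ?K"
    by (auto simp: ac.subspace_def intro: finite_subext_0 finite_subext_add finite_subext_mult to_ac_in_finite_subext)
  then have spanB: "ac.span B = ?K" using B(2,4) ac.span_minimal by blast
  have "CARD('k) ^ card B = CARD('k) ^ m"
    using ac.card_span_independent[OF B(3) finB] card_finite_subext[OF m(2), where 'k = 'k] spanB by simp
  then have cardB: "card B = m" using one_less_CARD_field[where 'k = 'k] by simp
  have "d - 1 \<le> card (B - {g - 1, 1})"
    using B(1) finB cardB assms g1(1) by (simp add: card_Diff_subset)
  then obtain A' where A': "A' \<subseteq> B - {g - 1, 1}" "card A' = d - 1" "finite A'"
    by (rule obtain_subset_with_card_n)
  define A where "A = insert (g - 1) A'"
  have A: "A \<subseteq> B - {1}" "finite A" "g - 1 \<in> A" using A' B(1) g1(1) by (auto simp: A_def)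
  have cardA: "card A = d"
    using A' assms by (subst A_def, subst card_insert_disjoint) auto
  have indA: "ac.independent A" using B(3) A(1) ac.independent_mono by blast
  obtain \<pi> and \<rho> :: "'k ^ 'n \<Rightarrow> 'k alg_closure" where lin: "linear_to_ac \<pi>" "linear_to_ac \<rho>"
    and bij: "bij_betw (\<lambda>v. (\<pi> v, \<rho> v)) UNIV (ac.span A \<times> ac.span B)"
    using ag_coordinates[OF indA A(2) B(3) finB, where 'n = 'n] cardA cardB assms(3) by auto
  have "graph_spread m (ac.span A) \<pi> \<rho>"
  proof (rule graph_spread.intro)
    show "ac.span A \<subseteq> ?K" using A(1) spanB ac.span_mono[of A B] by blast
    have "1 \<notin> ac.span (B - {1})" using B(1,3) by (auto simp: ac.dependent_def)
    then have "1 \<notin> ac.span A" using A(1) ac.span_mono by blast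
    then show "- 1 \<notin> ac.span A" using ac.span_neg by fastforce
  qed (use lin bij spanB in simp_all)
  moreover have "card (ac.span A) = CARD('k) ^ d"
    using ac.card_span_independent[OF indA A(2)] cardA by simp
  ultimately show thesis using gen ac.span_base[OF A(3)] by (intro that)
qed

theorem theorem1:
  fixes d :: nat
  assumes "d \<ge> 1" and "CARD('n::finite) > 2 * d"
  shows "\<exists>P :: ('k::{field,finite} ^ 'n) set set.
    affine_spread d P \<and> completely_tight P \<and> irreducible_partition P"
proof -
  define m where "m = CARD('n) - d"
  have m: "d < m" "d + m = CARD('n)" using assms by (simp_all add: m_def)
  obtain U :: "'k alg_closure set" and \<pi> \<rho> :: "'k ^ 'n \<Rightarrow> 'k alg_closure" and g
    where U: "graph_spread m U \<pi> \<rho>" "card U = CARD('k) ^ d" "g - 1 \<in> U"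
    and gen: "\<forall>x\<in>finite_subext m - {0}. \<exists>i. x = g ^ i"
    by (rule ex_graph_spread[OF assms(1) m, where 'k = 'k])
  interpret graph_spread m U \<pi> \<rho> by (rule U(1))
  show ?thesis
    using affine_spread_cells[OF U(2)] completely_tight_cells irreducible_cells[OF U(3) gen]
    by (intro exI conjI)
qed

end
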